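(* Let $s\geq0$ and $k=2^s$. Let $B_1,\dots,B_k\subset\mathbb{R}$ be finite sets with $|B_i|=N$ and $|B_i+B_i-B_i|=K_iN$ for $1\leq i\leq k$, let $f_1,\dots,f_k$ be $s$-convex functions, and set $A_i=f_i(B_i)$. Then \[ T(A_1,\dots,A_k)\ll \Big(\prod_{i=1}^k K_i^{\,2-(2+2s-2\alpha_s)2^{-s}}\Big)\, N^{2^{s+1}-1-s+\alpha_s}, \] where $\alpha_0=0$, $\alpha_s=\sum_{j=1}^s j2^{-j}$, and the implied constant depends only on $s$.
   Context: A function $f:\mathbb{R}\to\mathbb{R}$ is $s$-convex if $f\in C^s(\mathbb{R})$ and each of $f=f^{(0)},f^{(1)},\dots,f^{(s)}$ is strictly monotone (a $0$-convex function is a strictly monotone function). For finite $A_1,\dots,A_k\subset\mathbb{R}$, $T(A_1,\dots,A_k)$ is the number of solutions of $a_1+\dots+a_k=a_1'+\dots+a_k'$ with $a_i,a_i'\in A_i$. $B+B-B=\{b_1+b_2-b_3: b_j\in B\}$. *)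

theory Defs
  imports "HOL-Analysis.Analysis"
begin

definition strictly_monotone :: "(real \<Rightarrow> real) \<Rightarrow> bool" where
  "strictly_monotone g \<longleftrightarrow>
     (\<forall>x y. x < y \<longrightarrow> g x < g y) \<or> (\<forall>x y. x < y \<longrightarrow> g y < g x)"

definition s_convex :: "nat \<Rightarrow> (real \<Rightarrow> real) \<Rightarrow> bool" where
  "s_convex s f \<longleftrightarrow>
     (\<forall>j<s. \<forall>x. ((deriv ^^ j) f has_real_derivative (deriv ^^ Suc j) f x) (at x)) \<and>
     continuous_on UNIV ((deriv ^^ s) f) \<and>
     (\<forall>j\<le>s. strictly_monotone ((deriv ^^ j) f))"

definition sumdiff :: "real set \<Rightarrow> real set" where
  "sumdiff B = {b1 + b2 - b3 | b1 b2 b3. b1 \<in> B \<and> b2 \<in> B \<and> b3 \<in> B}"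

text \<open>T(A_0,...,A_{k-1}): number of solutions of a_0+...+a_{k-1} = a'_0+...+a'_{k-1},
  a_i, a'_i in A_i. Tuples are functions on nat that vanish outside {..<k}.\<close>
definition T_energy :: "nat \<Rightarrow> (nat \<Rightarrow> real set) \<Rightarrow> nat" where
  "T_energy k A = card {(a, a'). (\<forall>i<k. a i \<in> A i \<and> a' i \<in> A i) \<and>
       (\<forall>i\<ge>k. a i = 0 \<and> a' i = 0) \<and> (\<Sum>i<k. a i) = (\<Sum>i<k. a' i)}"

definition alpha :: "nat \<Rightarrow> real" where
  "alpha s = (\<Sum>j=1..s. real j / 2 ^ j)"

end

theory Submission
  imports Defs
begin

text \<open>
  The energy is the mean over the frequency of a product of squared moduli of exponential sums, so by
  AM-GM one may assume that all \<open>k = 2\<^sup>s\<close> functions and sets coincide with one pair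
  \<open>f, B\<close>; put \<open>n = |B|\<close> and \<open>L = |B+B-B|\<close>. Cut \<open>B\<close> into \<open>t\<close> cells of
  consecutive points, each spanning at most \<open>L/t\<close> elements of \<open>B+B-B\<close>. A level set of
  \<open>\<Sum>\<^sub>i f(x\<^sub>i)\<close> meets \<open>O(t\<^bsup>k-1\<^esup>)\<close> of the \<open>t\<^bsup>k\<^esup>\<close>
  product cells, so by Cauchy-Schwarz the energy is \<open>O(t\<^bsup>k-1\<^esup>)\<close> times the number of
  solutions \<open>(x, y)\<close> with both tuples in the same product cell. In such a solution every
  \<open>h\<^sub>i = y\<^sub>i - x\<^sub>i\<close> is zero or one of at most \<open>2L/t\<close> differences, and for
  \<open>h \<noteq> 0\<close> the function \<open>x \<mapsto> f(x+h) - f(x)\<close> is \<open>(s-1)\<close>-convex. Convexity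
  of the \<open>k\<close>-th power, applied to the exponential sums, reduces the mixed solutions (some but not all
  \<open>h\<^sub>i\<close> zero) to the two pure cases: all \<open>h\<^sub>i = 0\<close>, which contributes
  \<open>n\<^bsup>k\<^esup>\<close>, and all nonzero, which contributes \<open>(2L/t)\<^bsup>k\<^esup>\<close> times an energy of
  \<open>k/2\<close> terms, bounded by induction. The choice
  \<open>t = (L\<^sup>2/n)\<^bsup>1-s/k\<^esup>\<close> gives the exponents.
\<close>

subsection \<open>Means of trigonometric sums\<close>

text \<open>The frequencies that occur are arbitrary reals without a common period, so limits of
  averages over \<open>{0..R}\<close> take the place of integrals over a period. Continuity is
  bundled in so that all these integrals exist.\<close>

definition has_mean :: "(real \<Rightarrow> real) \<Rightarrow> real \<Rightarrow> bool" where
  "has_mean g m \<longleftrightarrow>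
     continuous_on UNIV g \<and> ((\<lambda>R. integral {0..R} g / R) \<longlongrightarrow> m) at_top"

lemma has_mean_integrable: "has_mean g m \<Longrightarrow> g integrable_on {0..R}"
  unfolding has_mean_def by (meson continuous_on_subset integrable_continuous_real subset_UNIV)

lemma has_mean_const: "has_mean (\<lambda>_. c) c"
proof -
  have "\<forall>\<^sub>F R in at_top. integral {0..R} (\<lambda>_. c) / R = c"
    using eventually_gt_at_top[of 0] by eventually_elim (simp add: field_simps)
  then show ?thesis
    unfolding has_mean_def by (auto intro: tendsto_eventually)
qed

lemma has_mean_add:
  assumes "has_mean f a" "has_mean g b"
  shows "has_mean (\<lambda>x. f x + g x) (a + b)"
proof -
  have "(\<lambda>R. integral {0..R} (\<lambda>x. f x + g x) / R) =
        (\<lambda>R. integral {0..R} f / R + integral {0..R} g / R)"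
    using assms by (simp add: integral_add has_mean_integrable add_divide_distrib)
  then show ?thesis
    using assms unfolding has_mean_def by (simp add: tendsto_add continuous_on_add)
qed

lemma has_mean_cmult:
  assumes "has_mean f a"
  shows "has_mean (\<lambda>x. c * f x) (c * a)"
proof -
  have "((\<lambda>R. c * (integral {0..R} f / R)) \<longlongrightarrow> c * a) at_top"
    using assms unfolding has_mean_def by (intro tendsto_mult_left) simp
  then show ?thesis
    using assms unfolding has_mean_def by (simp add: continuous_on_mult_left)
qed

lemma has_mean_sum:
  assumes "finite I" "\<And>i. i \<in> I \<Longrightarrow> has_mean (f i) (a i)"
  shows "has_mean (\<lambda>x. \<Sum>i\<in>I. f i x) (\<Sum>i\<in>I. a i)"
  using assms by (induction I rule: finite_induct) (auto simp: has_mean_const intro: has_mean_add)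

lemma has_mean_mono:
  assumes "has_mean f a" "has_mean g b" "\<And>x. f x \<le> g x"
  shows "a \<le> b"
proof -
  have "\<forall>\<^sub>F R in at_top. integral {0..R} f / R \<le> integral {0..R} g / R"
    using eventually_gt_at_top[of 0]
    by eventually_elim
      (use assms in \<open>auto intro!: divide_right_mono integral_le has_mean_integrable\<close>)
  then show ?thesis
    using assms unfolding has_mean_def
    by (intro tendsto_le[of at_top "\<lambda>R. integral {0..R} g / R" b "\<lambda>R. integral {0..R} f / R" a]) auto
qed

text \<open>For \<open>c \<noteq> 0\<close> the integral is \<open>sin (R * c) / c\<close>, which
  stays bounded while it is divided by \<open>R\<close>. This orthogonality is what lets a mean
  count solutions of an equation.\<close>

lemma has_mean_cos: "has_mean (\<lambda>x. cos (x * c)) (if c = 0 then 1 else 0)"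
proof (cases "c = 0")
  case True
  then show ?thesis
    using has_mean_const[of 1] by simp
next
  case False
  have int: "integral {0..R} (\<lambda>x. cos (x * c)) = sin (R * c) / c" if "R > 0" for R
  proof -
    have "((\<lambda>x. cos (x * c)) has_integral (sin (R * c) / c - sin (0 * c) / c)) {0..R}"
      by (rule fundamental_theorem_of_calculus)
        (use that False in \<open>auto intro!: derivative_eq_intros
           simp flip: has_real_derivative_iff_has_vector_derivative\<close>)
    then show ?thesis by (simp add: integral_unique)
  qed
  have lim: "((\<lambda>R. (1 / \<bar>c\<bar>) * inverse R) \<longlongrightarrow> (1 / \<bar>c\<bar>) * 0) at_top"
    by (intro tendsto_mult tendsto_const tendsto_inverse_0_at_top filterlim_ident)
  have "\<forall>\<^sub>F R in at_top. norm (integral {0..R} (\<lambda>x. cos (x * c)) / R) \<le> (1 / \<bar>c\<bar>) * inverse R"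
    using eventually_gt_at_top[of 0]
  proof eventually_elim
    case (elim R)
    then show ?case
      using False abs_sin_le_one[of "R * c"]
      by (simp add: int abs_mult field_simps)
  qed
  from Lim_null_comparison[OF this lim[unfolded mult_zero_right]] show ?thesis
    using False unfolding has_mean_def by (auto intro!: continuous_intros)
qed

lemma has_mean_sum_cos:
  assumes "finite X"
  shows "has_mean (\<lambda>\<xi>. \<Sum>x\<in>X. cos (\<xi> * \<phi> x)) (real (card {x\<in>X. \<phi> x = 0}))"
proof -
  have "(\<Sum>x\<in>X. if \<phi> x = 0 then 1 else 0) = real (card {x\<in>X. \<phi> x = 0})"
    using assms by (simp add: sum.If_cases Int_def)
  then show ?thesis
    using has_mean_sum[OF assms, of "\<lambda>x \<xi>. cos (\<xi> * \<phi> x)", OF has_mean_cos] by simp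
qed

subsection \<open>Additive energy of parametrised sets\<close>

text \<open>The count runs over parameters \<open>x i\<close> and not over values of
  \<open>f i\<close>, so passing to cells changes only the sets. \<open>PiE\<close> is the index set
  produced by expanding a product of sums.\<close>

definition energy :: "nat \<Rightarrow> (nat \<Rightarrow> real set) \<Rightarrow> (nat \<Rightarrow> real \<Rightarrow> real) \<Rightarrow> nat" where
  "energy k B f = card {(x, y). x \<in> PiE {..<k} B \<and> y \<in> PiE {..<k} B \<and>
     (\<Sum>i<k. f i (x i)) = (\<Sum>i<k. f i (y i))}"

definition expsum :: "real set \<Rightarrow> (real \<Rightarrow> real) \<Rightarrow> real \<Rightarrow> complex" where
  "expsum B f \<xi> = (\<Sum>b\<in>B. cis (\<xi> * f b))"

lemma cis_sum: "finite I \<Longrightarrow> cis (\<Sum>i\<in>I. g i) = (\<Prod>i\<in>I. cis (g i))"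
  by (induction I rule: finite_induct) (auto simp: cis_mult[symmetric])

lemma norm_sum_cis_squared:
  "(cmod (\<Sum>x\<in>X. cis (\<xi> * \<sigma> x)))\<^sup>2 = (\<Sum>(x, y)\<in>X \<times> X. cos (\<xi> * (\<sigma> x - \<sigma> y)))"
proof -
  have "complex_of_real ((cmod (\<Sum>x\<in>X. cis (\<xi> * \<sigma> x)))\<^sup>2) =
        (\<Sum>x\<in>X. cis (\<xi> * \<sigma> x)) * (\<Sum>y\<in>X. cis (- (\<xi> * \<sigma> y)))"
    by (subst complex_norm_square) (simp add: cis_cnj)
  also have "\<dots> = (\<Sum>(x, y)\<in>X \<times> X. cis (\<xi> * (\<sigma> x - \<sigma> y)))"
    by (simp add: sum_product sum.cartesian_product cis_mult algebra_simps)
  finally have "(cmod (\<Sum>x\<in>X. cis (\<xi> * \<sigma> x)))\<^sup>2 = Re (\<Sum>(x, y)\<in>X \<times> X. cis (\<xi> * (\<sigma> x - \<sigma> y)))"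
    by (metis Re_complex_of_real)
  then show ?thesis by (simp add: case_prod_unfold)
qed

text \<open>The expanded product has one exponential per tuple. Its squared modulus is a cosine sum
  over pairs of tuples, and averaging keeps exactly the pairs with equal sums.\<close>

lemma has_mean_energy:
  assumes "\<And>i. i < k \<Longrightarrow> finite (B i)"
  shows "has_mean (\<lambda>\<xi>. \<Prod>i<k. (cmod (expsum (B i) (f i) \<xi>))\<^sup>2) (real (energy k B f))"
proof -
  let ?X = "PiE {..<k} B"
  let ?\<sigma> = "\<lambda>x. \<Sum>i<k. f i (x i)"
  have fin: "finite ?X" using assms by (auto intro: finite_PiE)
  have "(\<Prod>i<k. expsum (B i) (f i) \<xi>) = (\<Sum>x\<in>?X. cis (\<xi> * ?\<sigma> x))" for \<xi>
    unfolding expsum_def using assms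
    by (subst prod_sum_PiE) (auto simp: sum_distrib_left cis_sum)
  then have prod: "(\<Prod>i<k. (cmod (expsum (B i) (f i) \<xi>))\<^sup>2) =
        (\<Sum>p\<in>?X \<times> ?X. cos (\<xi> * (?\<sigma> (fst p) - ?\<sigma> (snd p))))" for \<xi>
    by (simp only: prod_power_distrib[symmetric] prod_norm norm_sum_cis_squared case_prod_unfold)
  have zero: "{p \<in> ?X \<times> ?X. ?\<sigma> (fst p) - ?\<sigma> (snd p) = 0} =
      {(x, y). x \<in> ?X \<and> y \<in> ?X \<and> ?\<sigma> x = ?\<sigma> y}"
    by (simp only: set_eq_iff mem_Collect_eq case_prod_unfold mem_Times_iff
        right_minus_eq conj_assoc simp_thms)
  show ?thesis
    unfolding energy_def prod zero[symmetric]
    by (rule has_mean_sum_cos) (simp add: fin)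
qed

text \<open>Choosing preimages lifts every solution in values to one in parameters. The map
  \<open>?g\<close> returns to values and refills with \<open>0\<close> beyond \<open>k\<close>,
  which reconciles the two conventions for tuples.\<close>

lemma T_energy_image_le:
  assumes "\<And>i. i < k \<Longrightarrow> finite (B i)"
  shows "T_energy k (\<lambda>i. f i ` B i) \<le> energy k B f"
proof -
  let ?X = "PiE {..<k} B"
  let ?E = "{(x, y). x \<in> ?X \<and> y \<in> ?X \<and> (\<Sum>i<k. f i (x i)) = (\<Sum>i<k. f i (y i))}"
  let ?T = "{(a, a'). (\<forall>i<k. a i \<in> f i ` B i \<and> a' i \<in> f i ` B i) \<and>
       (\<forall>i\<ge>k. a i = 0 \<and> a' i = 0) \<and> (\<Sum>i<k. a i) = (\<Sum>i<k. a' i)}"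
  let ?g = "\<lambda>x i. if i < k then f i (x i) else 0"
  have "finite (?X \<times> ?X)" using assms by (auto intro: finite_PiE)
  then have fin: "finite ?E" by (rule rev_finite_subset) auto
  have lift: "\<exists>x\<in>?X. a = ?g x" if "\<forall>i<k. a i \<in> f i ` B i" "\<forall>i\<ge>k. a i = 0" for a
  proof -
    have "\<forall>i\<in>{..<k}. \<exists>b. b \<in> B i \<and> a i = f i b"
      using that(1) by blast
    then obtain x where x: "\<forall>i\<in>{..<k}. x i \<in> B i \<and> a i = f i (x i)"
      using bchoice[of "{..<k}" "\<lambda>i b. b \<in> B i \<and> a i = f i b"] by blast
    have "restrict x {..<k} \<in> ?X" "a = ?g (restrict x {..<k})"
      using x that(2) by (auto simp: fun_eq_iff)
    then show ?thesis by blast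
  qed
  have "?T \<subseteq> (\<lambda>(x, y). (?g x, ?g y)) ` ?E"
  proof
    fix p assume p: "p \<in> ?T"
    obtain a a' where aa: "p = (a, a')" by fastforce
    obtain x y where "x \<in> ?X" "y \<in> ?X" "a = ?g x" "a' = ?g y"
      using p lift[of a] lift[of a'] unfolding aa by auto
    then show "p \<in> (\<lambda>(x, y). (?g x, ?g y)) ` ?E"
      using p unfolding aa by (intro image_eqI[of _ _ "(x, y)"]) auto
  qed
  then show ?thesis
    unfolding T_energy_def energy_def by (rule surj_card_le[OF fin])
qed

subsection \<open>Restricting to solutions in a common cell\<close>

lemma card_eq_sum_fibres:
  assumes "finite P" "finite V" "\<And>p. p \<in> P \<Longrightarrow> g p \<in> V"
  shows "card P = (\<Sum>v\<in>V. card {p\<in>P. g p = v})"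
  using sum.group[of P V g "\<lambda>_. 1 :: nat"] assms by (simp add: image_subset_iff)

lemma card_pairs_eq:
  assumes "finite X"
  shows "card {p \<in> X \<times> X. g (fst p) = g (snd p)} = (\<Sum>v\<in>g ` X. (card {x\<in>X. g x = v})\<^sup>2)"
proof -
  have "card {p \<in> X \<times> X. g (fst p) = g (snd p)} =
        (\<Sum>v\<in>g ` X. card {p \<in> {p \<in> X \<times> X. g (fst p) = g (snd p)}. g (fst p) = v})"
    by (rule card_eq_sum_fibres) (use assms in auto)
  moreover have "{p \<in> {p \<in> X \<times> X. g (fst p) = g (snd p)}. g (fst p) = v} =
      {x\<in>X. g x = v} \<times> {x\<in>X. g x = v}" for v
    by auto
  ultimately show ?thesis
    by (simp add: card_cartesian_product power2_eq_square)
qed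

text \<open>Cauchy-Schwarz on each fibre of \<open>\<sigma>\<close>, which \<open>c\<close> splits
  into at most \<open>m\<close> classes: the square of the fibre size is at most \<open>m\<close>
  times the sum of the squares of the class sizes.\<close>

lemma card_pairs_le_refined:
  fixes \<sigma> :: "'a \<Rightarrow> 'b" and c :: "'a \<Rightarrow> 'c"
  assumes fin: "finite X" and m: "\<And>v. card (c ` {x\<in>X. \<sigma> x = v}) \<le> m"
  shows "card {p \<in> X \<times> X. \<sigma> (fst p) = \<sigma> (snd p)}
    \<le> m * card {p \<in> X \<times> X. \<sigma> (fst p) = \<sigma> (snd p) \<and> c (fst p) = c (snd p)}"
proof -
  let ?X = "\<lambda>v. {x\<in>X. \<sigma> x = v}"
  let ?P = "{p \<in> X \<times> X. \<sigma> (fst p) = \<sigma> (snd p) \<and> c (fst p) = c (snd p)}"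
  have fibre: "(card (?X v))\<^sup>2 \<le> m * card {p \<in> ?P. \<sigma> (fst p) = v}" for v
  proof -
    let ?n = "\<lambda>w. card {x \<in> ?X v. c x = w}"
    have "{p \<in> ?P. \<sigma> (fst p) = v} = {p \<in> ?X v \<times> ?X v. c (fst p) = c (snd p)}"
      by auto
    then have sq: "card {p \<in> ?P. \<sigma> (fst p) = v} = (\<Sum>w\<in>c ` ?X v. (?n w)\<^sup>2)"
      using card_pairs_eq[of "?X v" c] fin by simp
    have "card (?X v) = (\<Sum>w\<in>c ` ?X v. ?n w)"
      by (rule card_eq_sum_fibres) (use fin in auto)
    then have "(real (card (?X v)))\<^sup>2 = (\<Sum>w\<in>c ` ?X v. real (?n w))\<^sup>2"
      by simp
    also have "\<dots> \<le> (\<Sum>w\<in>c ` ?X v. (real (?n w))\<^sup>2) * card (c ` ?X v)"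
      by (rule sum_squared_le_sum_of_squares)
    also have "\<dots> = real (card {p \<in> ?P. \<sigma> (fst p) = v} * card (c ` ?X v))"
      unfolding sq by simp
    also have "\<dots> \<le> real (card {p \<in> ?P. \<sigma> (fst p) = v} * m)"
      using m[of v] by (intro of_nat_mono mult_left_mono) auto
    finally have "real ((card (?X v))\<^sup>2) \<le> real (card {p \<in> ?P. \<sigma> (fst p) = v} * m)"
      by simp
    then show ?thesis
      by (simp only: of_nat_le_iff mult.commute)
  qed
  have "card {p \<in> X \<times> X. \<sigma> (fst p) = \<sigma> (snd p)} = (\<Sum>v\<in>\<sigma> ` X. (card (?X v))\<^sup>2)"
    by (rule card_pairs_eq[OF fin])
  also have "\<dots> \<le> (\<Sum>v\<in>\<sigma> ` X. m * card {p \<in> ?P. \<sigma> (fst p) = v})"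
    by (intro sum_mono fibre)
  also have "\<dots> = m * card ?P"
    unfolding sum_distrib_left[symmetric]
    by (subst card_eq_sum_fibres[of ?P "\<sigma> ` X" "\<lambda>p. \<sigma> (fst p)"]) (use fin in auto)
  finally show ?thesis .
qed

text \<open>A monotone hypersurface meets every diagonal line of cells at most once.\<close>
lemma card_cells_hit_le:
  fixes f :: "real \<Rightarrow> real" and c :: "real \<Rightarrow> nat"
  assumes f: "strictly_monotone f" and c_mono: "\<And>x y. x \<le> y \<Longrightarrow> c x \<le> c y"
    and c_less: "\<And>b. b \<in> B \<Longrightarrow> c b < t" and k: "k > 0"
  shows "card ((\<lambda>x. restrict (\<lambda>i. c (x i)) {..<k}) ` {x \<in> PiE {..<k} (\<lambda>_. B). (\<Sum>i<k. f (x i)) = v})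
    \<le> (2 * t) ^ (k - 1)"
proof -
  let ?cv = "\<lambda>x. restrict (\<lambda>i. c (x i)) {..<k}"
  let ?X = "{x \<in> PiE {..<k} (\<lambda>_. B). (\<Sum>i<k. f (x i)) = v}"
  \<comment> \<open>A diagonal line of cells is labelled by the differences of its indices to index
    \<open>0\<close>. Each of the other \<open>k - 1\<close> differences lies in
    \<open>{- int t..<int t}\<close>, which has \<open>2 * t\<close> elements.\<close>
  define D where "D = PiE {1..<k} (\<lambda>_. {- int t..<int t})"
  define \<delta> where "\<delta> = (\<lambda>w. restrict (\<lambda>i. int (w i) - int (w 0)) {1..<k})"
  \<comment> \<open>If every cell index increases, so does every coordinate, and then the sum of the
    \<open>f (x i)\<close> changes strictly.\<close>
  have no_shift: False if x: "x \<in> ?X" and y: "y \<in> ?X" and lt: "\<And>i. i < k \<Longrightarrow> c (x i) < c (y i)" for x y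
  proof -
    have less: "x i < y i" if "i < k" for i
      using lt[OF that] c_mono[of "y i" "x i"] by linarith
    have ne: "{..<k} \<noteq> {}" using k by auto
    have "(\<Sum>i<k. f (x i)) \<noteq> (\<Sum>i<k. f (y i))"
    proof (cases "\<forall>x y. x < y \<longrightarrow> f x < f y")
      case True
      then have "(\<Sum>i<k. f (x i)) < (\<Sum>i<k. f (y i))"
        using less ne by (intro sum_strict_mono) auto
      then show ?thesis by simp
    next
      case False
      then have "(\<Sum>i<k. f (y i)) < (\<Sum>i<k. f (x i))"
        using less ne f unfolding strictly_monotone_def by (intro sum_strict_mono) auto
      then show ?thesis by simp
    qed
    then show False using x y by simp
  qed
  have "inj_on \<delta> (?cv ` ?X)"
  proof (rule inj_onI)
    fix w w' assume "w \<in> ?cv ` ?X" "w' \<in> ?cv ` ?X" and eq: "\<delta> w = \<delta> w'"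
    then obtain x y where x: "x \<in> ?X" "w = ?cv x" and y: "y \<in> ?X" "w' = ?cv y"
      by blast
    have diff: "int (c (x i)) - int (c (x 0)) = int (c (y i)) - int (c (y 0))" if "i < k" for i
      using fun_cong[OF eq, of i] that k x(2) y(2) by (cases "i = 0") (auto simp: \<delta>_def)
    have "\<not> c (x 0) < c (y 0)"
    proof
      assume "c (x 0) < c (y 0)"
      then have "c (x i) < c (y i)" if "i < k" for i using diff[OF that] by linarith
      then show False using no_shift[OF x(1) y(1)] by blast
    qed
    moreover have "\<not> c (y 0) < c (x 0)"
    proof
      assume "c (y 0) < c (x 0)"
      then have "c (y i) < c (x i)" if "i < k" for i using diff[OF that] by linarith
      then show False using no_shift[OF y(1) x(1)] by blast
    qed
    ultimately have "c (x i) = c (y i)" if "i < k" for i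
      using diff[OF that] by linarith
    then show "w = w'" unfolding x(2) y(2) by (intro restrict_ext) auto
  qed
  moreover have "\<delta> ` (?cv ` ?X) \<subseteq> D"
  proof
    fix d assume "d \<in> \<delta> ` (?cv ` ?X)"
    then obtain x where x: "x \<in> ?X" "d = \<delta> (?cv x)" by blast
    have lt: "c (x i) < t" if "i < k" for i
      using c_less[of "x i"] x(1) that by auto
    show "d \<in> D"
      unfolding D_def x(2) \<delta>_def
    proof (rule restrict_PiE_iff[THEN iffD2], rule ballI)
      fix i assume "i \<in> {1..<k}"
      then show "int (?cv x i) - int (?cv x 0) \<in> {- int t..<int t}"
        using lt[of i] lt[of 0] k by auto
    qed
  qed
  moreover have "finite D" unfolding D_def by (intro finite_PiE) auto
  ultimately have "card (?cv ` ?X) \<le> card D"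
    by (rule card_inj_on_le)
  also have "card D = (2 * t) ^ (k - 1)"
    unfolding D_def by (simp add: card_PiE nat_mult_distrib power_mult_distrib)
  finally show ?thesis .
qed

text \<open>A level set meets at most \<open>(2 * t) ^ (k - 1)\<close> product cells, which is the
  \<open>m\<close> of the refined pair count. The pairs that survive are sorted by their common
  vector \<open>w\<close> of cells.\<close>

lemma energy_le_sum_cells:
  fixes f :: "real \<Rightarrow> real" and c :: "real \<Rightarrow> nat"
  assumes fin: "finite B" and f: "strictly_monotone f"
    and c_mono: "\<And>x y. x \<le> y \<Longrightarrow> c x \<le> c y"
    and c_less: "\<And>b. b \<in> B \<Longrightarrow> c b < t" and k: "k > 0"
  shows "energy k (\<lambda>_. B) (\<lambda>_. f) \<le>
    (2 * t) ^ (k - 1) * (\<Sum>w\<in>PiE {..<k} (\<lambda>_. {..<t}). energy k (\<lambda>i. {b\<in>B. c b = w i}) (\<lambda>_. f))"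
proof -
  let ?X = "PiE {..<k} (\<lambda>_. B)"
  let ?\<sigma> = "\<lambda>x. \<Sum>i<k. f (x i)"
  let ?cv = "\<lambda>x. restrict (\<lambda>i. c (x i)) {..<k}"
  let ?P = "{p \<in> ?X \<times> ?X. ?\<sigma> (fst p) = ?\<sigma> (snd p) \<and> ?cv (fst p) = ?cv (snd p)}"
  let ?W = "PiE {..<k} (\<lambda>_. {..<t})"
  have finX: "finite ?X" using fin by (intro finite_PiE) auto
  then have finP: "finite ?P" by (intro finite_Collect_conjI disjI1) simp
  have "energy k (\<lambda>_. B) (\<lambda>_. f) = card {p \<in> ?X \<times> ?X. ?\<sigma> (fst p) = ?\<sigma> (snd p)}"
    unfolding energy_def by (simp only: case_prod_unfold mem_Times_iff conj_assoc)
  also have "\<dots> \<le> (2 * t) ^ (k - 1) * card ?P"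
    by (rule card_pairs_le_refined[OF finX card_cells_hit_le[OF f c_mono c_less k]])
  also have "card ?P = (\<Sum>w\<in>?W. card {p\<in>?P. ?cv (fst p) = w})"
  proof (rule card_eq_sum_fibres[OF finP])
    show "finite ?W" by (intro finite_PiE) auto
    show "?cv (fst p) \<in> ?W" if "p \<in> ?P" for p
    proof (rule restrict_PiE_iff[THEN iffD2], rule ballI)
      fix i assume "i \<in> {..<k}"
      moreover have "fst p \<in> ?X" using that by (simp only: mem_Collect_eq mem_Times_iff)
      ultimately have "fst p i \<in> B" by (rule PiE_mem[rotated])
      then show "c (fst p i) \<in> {..<t}" using c_less by simp
    qed
  qed
  also have "\<dots> = (\<Sum>w\<in>?W. energy k (\<lambda>i. {b\<in>B. c b = w i}) (\<lambda>_. f))"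
  proof (rule sum.cong[OF refl])
    fix w assume w: "w \<in> ?W"
    have cv: "?cv x = w \<longleftrightarrow> (\<forall>i<k. c (x i) = w i)" for x
      using w by (auto simp: fun_eq_iff PiE_def extensional_def restrict_def)
    have X: "x \<in> PiE {..<k} (\<lambda>i. {b\<in>B. c b = w i}) \<longleftrightarrow> x \<in> ?X \<and> ?cv x = w" for x
      unfolding cv by (auto simp: PiE_iff)
    have "{p\<in>?P. ?cv (fst p) = w} = {(x, y). x \<in> PiE {..<k} (\<lambda>i. {b\<in>B. c b = w i}) \<and>
       y \<in> PiE {..<k} (\<lambda>i. {b\<in>B. c b = w i}) \<and> ?\<sigma> x = ?\<sigma> y}"
      unfolding X by (rule set_eqI) (simp only: mem_Collect_eq case_prod_unfold mem_Times_iff, metis)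
    then show "card {p\<in>?P. ?cv (fst p) = w} = energy k (\<lambda>i. {b\<in>B. c b = w i}) (\<lambda>_. f)"
      unfolding energy_def by (rule arg_cong)
  qed
  finally show ?thesis .
qed

text \<open>Summing the products over all vectors \<open>w\<close> of cells is the expansion of a
  \<open>k\<close>-th power, so the sum of energies becomes the mean of a power of one sum over
  cells.\<close>

lemma has_mean_cells:
  fixes c :: "real \<Rightarrow> nat"
  assumes fin: "finite B"
  shows "has_mean (\<lambda>\<xi>. (\<Sum>j<t. (cmod (expsum {b\<in>B. c b = j} f \<xi>))\<^sup>2) ^ k)
    (real (\<Sum>w\<in>PiE {..<k} (\<lambda>_. {..<t}). energy k (\<lambda>i. {b\<in>B. c b = w i}) (\<lambda>_. f)))"
proof -
  have eq: "(\<Sum>j<t. (cmod (expsum {b\<in>B. c b = j} f \<xi>))\<^sup>2) ^ k =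
     (\<Sum>w\<in>PiE {..<k} (\<lambda>_. {..<t}). \<Prod>i<k. (cmod (expsum {b\<in>B. c b = w i} f \<xi>))\<^sup>2)" for \<xi>
    using prod_sum_PiE[of "{..<k}" "\<lambda>_. {..<t}" "\<lambda>_ j. (cmod (expsum {b\<in>B. c b = j} f \<xi>))\<^sup>2"]
    by simp
  show ?thesis
    unfolding eq of_nat_sum
    by (intro has_mean_sum has_mean_energy finite_PiE) (use fin in auto)
qed

text \<open>Expanding the squares gives the pairs of points in a common cell. Grouped by their
  difference \<open>h\<close>, they contribute \<open>card B\<close> for \<open>h = 0\<close> and
  otherwise the real part of an exponential sum of the differenced function.\<close>

lemma sum_cells_le_differences:
  fixes c :: "real \<Rightarrow> nat" and f :: "real \<Rightarrow> real"
  assumes fin: "finite B" and c_less: "\<And>b. b \<in> B \<Longrightarrow> c b < t"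
    and H: "H = {y - x | x y. x \<in> B \<and> y \<in> B \<and> x \<noteq> y \<and> c x = c y}"
  shows "(\<Sum>j<t. (cmod (expsum {b\<in>B. c b = j} f \<xi>))\<^sup>2) \<le> real (card B) +
    (\<Sum>h\<in>H. cmod (expsum {b\<in>B. b + h \<in> B \<and> c b = c (b + h)} (\<lambda>x. f (x + h) - f x) \<xi>))"
proof -
  let ?P = "{p \<in> B \<times> B. c (fst p) = c (snd p)}"
  let ?B = "\<lambda>h. {b\<in>B. b + h \<in> B \<and> c b = c (b + h)}"
  let ?g = "\<lambda>p. cos (\<xi> * (f (fst p) - f (snd p)))"
  have "H \<subseteq> (\<lambda>p. snd p - fst p) ` (B \<times> B)" unfolding H by force
  then have finH: "finite H" using fin by (meson finite_SigmaI finite_imageI finite_subset)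
  have "0 \<notin> H" unfolding H by auto
  have finP: "finite ?P" using fin by simp
  have cell: "(cmod (expsum {b\<in>B. c b = j} f \<xi>))\<^sup>2 = (\<Sum>p\<in>{p \<in> ?P. c (fst p) = j}. ?g p)" for j
    unfolding expsum_def norm_sum_cis_squared case_prod_unfold
    by (rule sum.cong) auto
  have diff: "(\<Sum>p\<in>{p \<in> ?P. fst p - snd p = h}. ?g p) = Re (expsum (?B h) (\<lambda>x. f (x + h) - f x) \<xi>)" for h
  proof -
    have "(\<Sum>p\<in>{p \<in> ?P. fst p - snd p = h}. ?g p) = (\<Sum>b\<in>?B h. cos (\<xi> * (f (b + h) - f b)))"
      by (rule sum.reindex_bij_witness[of _ "\<lambda>b. (b + h, b)" snd]) auto
    then show ?thesis by (simp add: expsum_def)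
  qed
  have "(\<Sum>j<t. (cmod (expsum {b\<in>B. c b = j} f \<xi>))\<^sup>2) = (\<Sum>p\<in>?P. ?g p)"
    unfolding cell by (rule sum.group[OF finP]) (use c_less in auto)
  also have "\<dots> = (\<Sum>h\<in>insert 0 H. \<Sum>p\<in>{p \<in> ?P. fst p - snd p = h}. ?g p)"
  proof (rule sum.group[OF finP, symmetric])
    show "(\<lambda>p. fst p - snd p) ` ?P \<subseteq> insert 0 H"
      unfolding H by clarsimp metis
  qed (use finH in simp)
  also have "\<dots> = (\<Sum>p\<in>{p \<in> ?P. fst p - snd p = 0}. ?g p) +
      (\<Sum>h\<in>H. Re (expsum (?B h) (\<lambda>x. f (x + h) - f x) \<xi>))"
    by (simp only: diff sum.insert[OF finH \<open>0 \<notin> H\<close>])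
  finally have "(\<Sum>j<t. (cmod (expsum {b\<in>B. c b = j} f \<xi>))\<^sup>2) =
      (\<Sum>p\<in>{p \<in> ?P. fst p - snd p = 0}. ?g p) +
      (\<Sum>h\<in>H. Re (expsum (?B h) (\<lambda>x. f (x + h) - f x) \<xi>))" .
  moreover have "(\<Sum>p\<in>{p \<in> ?P. fst p - snd p = 0}. ?g p) = real (card B)"
    by (simp only: diff) (simp add: expsum_def)
  moreover have "(\<Sum>h\<in>H. Re (expsum (?B h) (\<lambda>x. f (x + h) - f x) \<xi>)) \<le>
     (\<Sum>h\<in>H. cmod (expsum (?B h) (\<lambda>x. f (x + h) - f x) \<xi>))"
    by (intro sum_mono complex_Re_le_cmod)
  ultimately show ?thesis by linarith
qed

subsection \<open>Cells defined by ranks in the sum-difference set\<close>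

lemma finite_sumdiff: "finite B \<Longrightarrow> finite (sumdiff B)"
proof -
  assume "finite B"
  moreover have "sumdiff B \<subseteq> (\<lambda>(x, y, z). x + y - z) ` (B \<times> B \<times> B)"
    unfolding sumdiff_def by force
  ultimately show ?thesis by (meson finite_SigmaI finite_imageI finite_subset)
qed

lemma subset_sumdiff: "B \<subseteq> sumdiff B"
  unfolding sumdiff_def by force

lemma sumdiff_mono: "A \<subseteq> B \<Longrightarrow> sumdiff A \<subseteq> sumdiff B"
  unfolding sumdiff_def by blast

text \<open>The cell index is the rank in \<open>sumdiff B\<close>, rescaled so that ranks within a
  cell differ by less than \<open>L / t\<close>. All smaller positive differences, from whichever
  cell, fit into \<open>sumdiff B\<close> between the endpoints of the largest one. Reflection of
  \<open>h\<close> gives the factor 2.\<close>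

lemma exists_cells:
  assumes fin: "finite B" and t: "t > 0"
  obtains c :: "real \<Rightarrow> nat" where "\<And>x y. x \<le> y \<Longrightarrow> c x \<le> c y" "\<And>b. b \<in> B \<Longrightarrow> c b < t"
    "card {y - x | x y. x \<in> B \<and> y \<in> B \<and> x \<noteq> y \<and> c x = c y} * t \<le> 2 * card (sumdiff B)"
proof -
  let ?D = "sumdiff B"
  define L where "L = card ?D"
  define rank where "rank x = card {d\<in>?D. d < x}" for x
  define c where "c x = rank x * t div L" for x
  have finD: "finite ?D" using fin by (rule finite_sumdiff)
  have rank_mono: "rank x \<le> rank y" if "x \<le> y" for x y
    unfolding rank_def using finD that by (intro card_mono) auto
  \<comment> \<open>The inequality is strict because \<open>b\<close> lies in
    \<open>sumdiff B\<close> itself but not below \<open>b\<close>; this keeps the cell index below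
    \<open>t\<close>.\<close>
  have rank_less: "rank b < L" if "b \<in> B" for b
    unfolding rank_def L_def using finD that subset_sumdiff[of B]
    by (intro psubset_card_mono) auto
  have c_mono: "c x \<le> c y" if "x \<le> y" for x y
    unfolding c_def using rank_mono[OF that] by (intro div_le_mono mult_le_mono1)
  have c_less: "c b < t" if "b \<in> B" for b
    unfolding c_def using rank_less[OF that] t
    by (metis div_less_iff_less_mult mult.commute mult_less_mono1 not_less_zero neq0_conv)
  define H where "H = {y - x | x y. x \<in> B \<and> y \<in> B \<and> x \<noteq> y \<and> c x = c y}"
  define Hp where "Hp = {h\<in>H. h > 0}"
  have "H \<subseteq> (\<lambda>p. snd p - fst p) ` (B \<times> B)" unfolding H_def by force
  then have "finite H" using fin by (meson finite_SigmaI finite_imageI finite_subset)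
  then have finHp: "finite Hp" unfolding Hp_def by simp
  have Hp: "card Hp * t \<le> L"
  proof (cases "Hp = {}")
    case False
    define h where "h = Max Hp"
    have "h \<in> Hp" using finHp False unfolding h_def by simp
    then obtain x y where xy: "x \<in> B" "y \<in> B" "c x = c y" "y = x + h" "h > 0"
      unfolding Hp_def H_def by force
    let ?S = "{d\<in>?D. x \<le> d \<and> d < y}"
    have rank_y: "rank y = rank x + card ?S"
    proof -
      have "{d\<in>?D. d < y} = {d\<in>?D. d < x} \<union> ?S" using xy by auto
      moreover have "{d\<in>?D. d < x} \<inter> ?S = {}" by auto
      ultimately show ?thesis
        unfolding rank_def using finD by (simp add: card_Un_disjoint)
    qed
    \<comment> \<open>Translating the smaller differences by \<open>x\<close> packs them into the part of \<open>B+B-B\<close> between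
      two points of one cell; \<open>0\<close> takes the place of the largest difference \<open>h\<close>.\<close>
    have inS: "x + g \<in> ?S" if "g \<in> insert 0 (Hp - {h})" for g
    proof (cases "g = 0")
      case True
      then show ?thesis using xy subset_sumdiff[of B] by auto
    next
      case False
      then have g: "g \<in> Hp" "g \<noteq> h" using that by auto
      then have "g < h" using finHp unfolding h_def by (simp add: less_le)
      moreover have "g > 0" using g unfolding Hp_def by simp
      moreover have "x + g \<in> ?D"
        using g(1) xy(1) unfolding Hp_def H_def sumdiff_def by clarsimp (metis add_diff_eq)
      ultimately show ?thesis using xy(4) by simp
    qed
    have "0 \<notin> Hp" unfolding Hp_def by simp
    then have "card Hp = card (insert 0 (Hp - {h}))"
      using finHp card_Suc_Diff1[OF finHp \<open>h \<in> Hp\<close>] by simp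
    also have "\<dots> \<le> card ?S"
    proof (rule card_inj_on_le)
      show "(\<lambda>g. x + g) ` insert 0 (Hp - {h}) \<subseteq> ?S" by (rule image_subsetI[OF inS])
      show "finite ?S" using finD by simp
      show "inj_on (\<lambda>g. x + g) (insert 0 (Hp - {h}))" by (rule inj_onI) simp
    qed
    finally have "rank x * t + card Hp * t \<le> rank y * t"
      unfolding rank_y by (simp add: add_mult_distrib)
    \<comment> \<open>Both products have the same quotient by \<open>L\<close>, so they differ by
      less than \<open>L\<close>.\<close>
    moreover have "rank y * t < rank x * t + L"
    proof -
      have "L > 0" using rank_less[OF xy(1)] by simp
      have "rank y * t < (rank y * t div L) * L + L"
        using \<open>L > 0\<close> by (metis add.commute dividend_less_div_times mult.commute)
      also have "rank y * t div L = rank x * t div L" using xy(3) unfolding c_def by simp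
      finally show ?thesis
        using div_times_less_eq_dividend[of "rank x * t" L] by linarith
    qed
    ultimately show ?thesis by simp
  qed simp
  have "H \<subseteq> Hp \<union> uminus ` Hp"
  proof
    fix h assume "h \<in> H"
    then obtain x y where xy: "x \<in> B" "y \<in> B" "x \<noteq> y" "c x = c y" "h = y - x"
      unfolding H_def by blast
    have "- h = x - y" using xy(5) by simp
    then have "- h \<in> H"
      unfolding H_def mem_Collect_eq by (intro exI[of _ y] exI[of _ x]) (use xy in auto)
    moreover have "h \<noteq> 0" using xy by simp
    moreover note \<open>h \<in> H\<close>
    ultimately show "h \<in> Hp \<union> uminus ` Hp"
      unfolding Hp_def by (cases "h > 0") (auto intro!: image_eqI[of h uminus "- h"])
  qed
  then have "card H \<le> card (Hp \<union> uminus ` Hp)"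
    using finHp by (intro card_mono) auto
  also have "\<dots> \<le> 2 * card Hp"
    using card_Un_le[of Hp "uminus ` Hp"] card_image_le[OF finHp, of uminus] by linarith
  finally have "card H * t \<le> 2 * L"
    using Hp mult_le_mono1[of "card H" "2 * card Hp" t] by linarith
  then show thesis
    using that c_mono c_less unfolding H_def L_def by blast
qed

subsection \<open>Differences of s-convex functions\<close>

text \<open>The derivative \<open>F' (x + h) - F' x\<close> has the same sign for all
  \<open>x\<close>, determined by the direction of \<open>F'\<close> and the sign of
  \<open>h\<close>.\<close>

lemma strictly_monotone_difference:
  assumes der: "\<And>x. (F has_real_derivative F' x) (at x)" and mono: "strictly_monotone F'" and "h \<noteq> 0"
  shows "strictly_monotone (\<lambda>x. F (x + h) - F x)"
proof -
  have der2: "((\<lambda>x. F (x + h) - F x) has_real_derivative F' (x + h) - F' x) (at x)" for x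
    using der by (intro DERIV_diff) (auto simp flip: DERIV_shift)
  consider "\<And>x. F' x < F' (x + h)" | "\<And>x. F' (x + h) < F' x"
    using mono \<open>h \<noteq> 0\<close> unfolding strictly_monotone_def
    by (metis add.commute add_0 add_less_cancel_right linorder_neqE_linordered_idom)
  then show ?thesis
  proof cases
    case 1
    have "F (x + h) - F x < F (y + h) - F y" if "x < y" for x y
      by (rule DERIV_pos_imp_increasing[OF that]) (use der2 1 in \<open>metis diff_gt_0_iff_gt\<close>)
    then show ?thesis unfolding strictly_monotone_def by blast
  next
    case 2
    have "F (y + h) - F y < F (x + h) - F x" if "x < y" for x y
      by (rule DERIV_neg_imp_decreasing[OF that]) (use der2 2 in \<open>metis diff_less_0_iff_less\<close>)
    then show ?thesis unfolding strictly_monotone_def by blast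
  qed
qed

text \<open>Differencing commutes with \<open>deriv\<close>. Monotonicity of the \<open>j\<close>-th
  derivative of the difference is drawn from derivative \<open>Suc j\<close> of \<open>f\<close>,
  which costs one order.\<close>

lemma s_convex_difference:
  assumes f: "s_convex (Suc s) f" and "h \<noteq> 0"
  shows "s_convex s (\<lambda>x. f (x + h) - f x)"
proof -
  let ?F = "\<lambda>j. (deriv ^^ j) f"
  let ?g = "\<lambda>x. f (x + h) - f x"
  have der: "(?F j has_real_derivative ?F (Suc j) x) (at x)" if "j \<le> s" for j x
    using f that unfolding s_convex_def by (metis le_imp_less_Suc)
  have der_diff: "((\<lambda>x. ?F j (x + h) - ?F j x) has_real_derivative ?F (Suc j) (x + h) - ?F (Suc j) x) (at x)"
    if "j \<le> s" for j x
    using der[OF that] by (intro DERIV_diff) (auto simp flip: DERIV_shift)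
  have g: "(deriv ^^ j) ?g = (\<lambda>x. ?F j (x + h) - ?F j x)" if "j \<le> s" for j
    using that
  proof (induction j)
    case (Suc j)
    then have "(deriv ^^ Suc j) ?g = deriv (\<lambda>x. ?F j (x + h) - ?F j x)"
      by simp
    also have "\<dots> = (\<lambda>x. ?F (Suc j) (x + h) - ?F (Suc j) x)"
      using der_diff[of j] Suc.prems by (intro ext DERIV_imp_deriv) simp
    finally show ?case .
  qed simp
  have "((deriv ^^ j) ?g has_real_derivative (deriv ^^ Suc j) ?g x) (at x)" if "j < s" for j x
    using der_diff[of j x] that by (simp only: g less_imp_le Suc_leI)
  moreover have "continuous_on UNIV ((deriv ^^ s) ?g)"
    unfolding g[OF order_refl]
    using der_diff[of s] by (intro DERIV_continuous_on) (auto intro: has_field_derivative_at_within)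
  moreover have "strictly_monotone ((deriv ^^ j) ?g)" if "j \<le> s" for j
  proof -
    have "strictly_monotone (?F (Suc j))"
      using f that unfolding s_convex_def by blast
    then show ?thesis
      unfolding g[OF that] using der[OF that] \<open>h \<noteq> 0\<close> by (intro strictly_monotone_difference)
  qed
  ultimately show ?thesis unfolding s_convex_def by blast
qed

subsection \<open>Inequalities\<close>

text \<open>Jensen with equal weights for the convex function \<open>x ^ k\<close>. It decouples the
  different shifts \<open>h\<close>, leaving pure powers whose means are energies of a single
  function.\<close>

lemma power_sum_le_even:
  fixes x :: "'a \<Rightarrow> real"
  assumes "even k" "k > 0"
  shows "(\<Sum>i\<in>I. x i) ^ k \<le> real (card I) ^ (k - 1) * (\<Sum>i\<in>I. x i ^ k)"
proof (cases "finite I \<and> I \<noteq> {}")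
  case True
  define m where "m = real (card I)"
  have m: "m > 0" using True unfolding m_def by (simp add: card_gt_0_iff)
  have "(\<Sum>i\<in>I. (1 / m) *\<^sub>R x i) ^ k \<le> (\<Sum>i\<in>I. (1 / m) * x i ^ k)"
    using True m
    by (intro convex_on_sum[OF _ _ convex_power_even[OF assms(1)]]) (auto simp: m_def)
  then have "((\<Sum>i\<in>I. x i) / m) ^ k \<le> (\<Sum>i\<in>I. x i ^ k) / m"
    by (simp flip: sum_divide_distrib)
  moreover have "m ^ k = m * m ^ (k - 1)"
    using assms(2) by (simp flip: power_Suc)
  ultimately show ?thesis
    using m unfolding m_def[symmetric] by (simp add: power_divide field_simps)
next
  case False
  then have "(\<Sum>i\<in>I. x i) = 0" "(\<Sum>i\<in>I. x i ^ k) = 0" by auto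
  then show ?thesis using assms(2) by (simp add: zero_power)
qed

lemma power_add_le:
  fixes a b :: real
  assumes "0 \<le> a" "0 \<le> b"
  shows "(a + b) ^ k \<le> 2 ^ k * (a ^ k + b ^ k)"
proof -
  have "(a + b) ^ k \<le> (2 * max a b) ^ k"
    using assms by (intro power_mono) auto
  also have "\<dots> = 2 ^ k * max a b ^ k"
    by (rule power_mult_distrib)
  also have "\<dots> \<le> 2 ^ k * (a ^ k + b ^ k)"
    using assms by (intro mult_left_mono) (auto simp: max_def)
  finally show ?thesis .
qed

text \<open>AM-GM for the numbers \<open>x i ^ k\<close>; each power is then a product of
  \<open>k\<close> equal factors, as in an energy of one set and one function.\<close>

lemma prod_le_mean_powers:
  fixes x :: "nat \<Rightarrow> real"
  assumes "k > 0" "\<And>i. i < k \<Longrightarrow> 0 \<le> x i"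
  shows "(\<Prod>i<k. x i) \<le> (\<Sum>i<k. x i ^ k) / k"
proof -
  have root: "y = (y ^ k) powr (1 / k)" if "0 \<le> y" for y :: real
  proof (cases "y = 0")
    case True
    then show ?thesis using assms(1) by (simp add: zero_power)
  next
    case False
    then show ?thesis
      using assms(1) that by (simp add: powr_powr flip: powr_realpow)
  qed
  have "(\<Prod>i<k. x i) = ((\<Prod>i<k. x i) ^ k) powr (1 / k)"
    using assms by (intro root prod_nonneg) auto
  also have "\<dots> = (\<Prod>i<k. x i ^ k) powr (1 / card {..<k})"
    by (simp add: prod_power_distrib)
  also have "\<dots> \<le> (\<Sum>i<k. x i ^ k / card {..<k})"
    using assms by (intro arith_geom_mean) auto
  finally show ?thesis by (simp add: sum_divide_distrib)
qed

subsection \<open>The exponents\<close>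

text \<open>The bound improves the trivial \<open>N\<^bsup>2k\<^esup>\<close> by a factor \<open>N\<close> to this power.\<close>
definition saving :: "nat \<Rightarrow> real" where
  "saving s = 1 + real s - alpha s"

lemma alpha_Suc: "alpha (Suc s) = alpha s + real (Suc s) / 2 ^ Suc s"
  unfolding alpha_def by simp

lemma saving_Suc: "saving (Suc s) = saving s + (1 - real (Suc s) / 2 ^ Suc s)"
  unfolding saving_def alpha_Suc by simp

lemma Suc_le_two_power: "real (Suc s) \<le> 2 ^ s"
proof -
  have "Suc s \<le> 2 ^ s" by (rule Suc_leI) (rule less_exp)
  then have "real (Suc s) \<le> real (2 ^ s)" by (rule of_nat_mono)
  then show ?thesis by simp
qed

text \<open>Together with \<open>saving_le\<close> this makes both exponents of the bound
  nonnegative, so that the bound for a subset of \<open>B\<close> passes to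
  \<open>B\<close>.\<close>

lemma saving_ge_1: "saving s \<ge> 1"
proof (induction s)
  case 0
  show ?case by (simp add: saving_def alpha_def)
next
  case (Suc s)
  have "real (Suc s) \<le> 2 ^ Suc s"
    using Suc_le_two_power[of "Suc s"] by simp
  then have "real (Suc s) / 2 ^ Suc s \<le> 1" by simp
  then show ?case using Suc.IH unfolding saving_Suc by linarith
qed

lemma alpha_ge: "real s / 2 ^ s \<le> alpha s"
proof (cases s)
  case (Suc r)
  have "alpha r \<ge> 0" unfolding alpha_def by (intro sum_nonneg) simp
  then show ?thesis unfolding Suc alpha_Suc by simp
qed (simp add: alpha_def)

lemma saving_le: "saving s \<le> 2 ^ s"
proof -
  have "0 \<le> alpha s" using alpha_ge[of s] by (rule order.trans[rotated]) simp
  then show ?thesis using Suc_le_two_power[of s] unfolding saving_def by simp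
qed

text \<open>This says that the diagonal term, of size \<open>t ^ (k - 1) * n ^ k\<close>, stays
  within the target. After expansion it is \<open>alpha_ge\<close>.\<close>

lemma saving_step_le: "(1 - real s / 2 ^ s) * (2 ^ s - 1) \<le> 2 ^ s - saving s"
proof -
  have "(1 - real s / 2 ^ s) * (2 ^ s - 1) = 2 ^ s - 1 - real s + real s / 2 ^ s"
    by (simp add: field_simps)
  then show ?thesis using alpha_ge[of s] unfolding saving_def by linarith
qed

text \<open>With \<open>u = L\<^sup>2 / n\<close> everything is a power of \<open>u\<close> times
  \<open>n ^ k\<close>. The diagonal term grows with \<open>t\<close> and fits by the hypothesis on
  \<open>\<theta>\<close>; the difference term behaves like \<open>1 / t\<close> and reaches the
  target power exactly, since \<open>\<sigma> = \<sigma>' + \<theta>\<close>.\<close>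

lemma balance_terms:
  fixes L n t M C \<theta> \<sigma> \<sigma>' :: real
  assumes n: "1 \<le> n" "n \<le> L" and k: "k > 0"
    and t: "(L\<^sup>2 / n) powr \<theta> \<le> t" "t \<le> 2 * (L\<^sup>2 / n) powr \<theta>"
    and M: "0 \<le> M" "M * t \<le> 2 * L"
    and \<theta>: "\<theta> * (real k - 1) \<le> real k - \<sigma>" and \<sigma>: "\<sigma> = \<sigma>' + \<theta>" and C: "0 \<le> C"
  shows "(2 * t) ^ (k - 1) * (2 ^ k * (n ^ k + M ^ k * (C * L powr (real k - 2 * \<sigma>') * n powr \<sigma>')))
    \<le> 8 ^ k * (1 + C) * (L powr (2 * (real k - \<sigma>)) * n powr \<sigma>)"
proof -
  define u where "u = L\<^sup>2 / n"
  have Lpos: "L > 0" and npos: "n > 0" using n by auto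
  have "n * 1 \<le> L * L" using n by (intro mult_mono) auto
  then have u: "u \<ge> 1" using npos unfolding u_def by (simp add: power2_eq_square)
  have tpos: "t > 0" using t(1) u unfolding u_def[symmetric]
    by (smt (verit) powr_gt_zero)
  have upow: "L powr (2 * (real k - \<beta>)) * n powr \<beta> = u powr (real k - \<beta>) * n ^ k" for \<beta>
  proof -
    have "u powr (real k - \<beta>) = L powr (2 * (real k - \<beta>)) / n powr (real k - \<beta>)"
      using Lpos npos unfolding u_def by (simp add: powr_divide powr_powr flip: powr_numeral)
    moreover have "n ^ k = n powr (real k - \<beta>) * n powr \<beta>"
      using npos by (simp flip: powr_add powr_realpow)
    ultimately show ?thesis using npos by simp
  qed
  define W where "W = u powr (real k - \<sigma>) * n ^ k"
  have W: "W \<ge> 0" unfolding W_def using npos by simp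
  have "t ^ (k - 1) \<le> (2 * u powr \<theta>) ^ (k - 1)"
    using t(2) tpos unfolding u_def by (intro power_mono) auto
  also have "\<dots> = 2 ^ (k - 1) * u powr (\<theta> * (real k - 1))"
    using u k by (simp add: power_mult_distrib powr_powr of_nat_diff flip: powr_realpow)
  also have "\<dots> \<le> 2 ^ k * u powr (real k - \<sigma>)"
    using u \<theta> by (intro mult_mono powr_mono power_increasing) auto
  finally have "t ^ (k - 1) * n ^ k \<le> 2 ^ k * u powr (real k - \<sigma>) * n ^ k"
    using npos by (intro mult_right_mono) auto
  then have term1: "t ^ (k - 1) * n ^ k \<le> 2 ^ k * W"
    unfolding W_def by simp
  let ?V = "C * L powr (real k - 2 * \<sigma>') * n powr \<sigma>'"
  have V: "?V \<ge> 0" using C by simp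
  \<comment> \<open>The factor \<open>u powr \<theta> \<le> t\<close> supplies the missing power of
    \<open>t\<close>, so that \<open>M * t \<le> 2 * L\<close> can be applied \<open>k\<close>
    times; it is cancelled at the end.\<close>
  have "u powr \<theta> * (t ^ (k - 1) * (M ^ k * ?V)) \<le> t * (t ^ (k - 1) * (M ^ k * ?V))"
    using t(1) tpos M(1) C unfolding u_def[symmetric]
    by (intro mult_right_mono mult_nonneg_nonneg) auto
  also have "\<dots> = (M * t) ^ k * ?V"
    using k by (cases k) (simp_all add: power_mult_distrib)
  also have "\<dots> \<le> (2 * L) ^ k * ?V"
    using M tpos V by (intro mult_right_mono power_mono) auto
  also have "\<dots> = 2 ^ k * C * ((L powr real k * L powr (real k - 2 * \<sigma>')) * n powr \<sigma>')"
    using Lpos by (simp add: power_mult_distrib powr_realpow)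
  also have "L powr real k * L powr (real k - 2 * \<sigma>') = L powr (2 * (real k - \<sigma>'))"
    by (simp flip: powr_add)
  also have "2 ^ k * C * (L powr (2 * (real k - \<sigma>')) * n powr \<sigma>') = u powr \<theta> * (2 ^ k * C * W)"
  proof -
    have "u powr (real k - \<sigma>') = u powr \<theta> * u powr (real k - \<sigma>)"
      unfolding \<sigma> by (simp flip: powr_add)
    then show ?thesis unfolding upow W_def by simp
  qed
  finally have term2: "t ^ (k - 1) * (M ^ k * ?V) \<le> 2 ^ k * C * W"
    using u by simp
  have "(2 * t) ^ (k - 1) * (2 ^ k * (n ^ k + M ^ k * ?V)) =
        2 ^ (k - 1) * 2 ^ k * (t ^ (k - 1) * n ^ k + t ^ (k - 1) * (M ^ k * ?V))"
    by (simp only: power_mult_distrib distrib_left mult.assoc mult.left_commute)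
  also have "\<dots> \<le> 2 ^ (k - 1) * 2 ^ k * (2 ^ k * W + 2 ^ k * C * W)"
    using term1 term2 by (intro mult_left_mono add_mono) auto
  also have "\<dots> \<le> 2 ^ k * 2 ^ k * (2 ^ k * W + 2 ^ k * C * W)"
    using W C by (intro mult_right_mono power_increasing add_nonneg_nonneg mult_nonneg_nonneg) auto
  also have "\<dots> = (2 ^ k * 2 ^ k * 2 ^ k) * (1 + C) * W"
    by (simp only: distrib_left distrib_right mult.assoc mult.left_commute mult_1_right mult_1_left)
  also have "2 ^ k * 2 ^ k * 2 ^ k = (8::real) ^ k"
    by (simp flip: power_mult_distrib)
  finally show ?thesis unfolding upow W_def .
qed

subsection \<open>The energy estimate\<close>

lemma energy_empty: "k > 0 \<Longrightarrow> B 0 = {} \<Longrightarrow> energy k B f = 0"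
  unfolding energy_def by (auto simp: PiE_eq_empty_iff)

lemma energy_one:
  assumes "finite B" "inj_on f B"
  shows "energy 1 (\<lambda>_. B) (\<lambda>_. f) \<le> card B"
proof -
  let ?E = "{(x, y). x \<in> PiE {..<1::nat} (\<lambda>_. B) \<and> y \<in> PiE {..<1::nat} (\<lambda>_. B) \<and>
     (\<Sum>i<1::nat. f (x i)) = (\<Sum>i<1::nat. f (y i))}"
  let ?g = "\<lambda>b. (\<lambda>i\<in>{..<1::nat}. b)"
  have "?E \<subseteq> (\<lambda>b. (?g b, ?g b)) ` B"
  proof
    fix p assume "p \<in> ?E"
    then obtain x y where p: "p = (x, y)" "x \<in> PiE {..<1::nat} (\<lambda>_. B)" "y \<in> PiE {..<1::nat} (\<lambda>_. B)"
        "f (x 0) = f (y 0)"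
      by auto
    have mem: "x 0 \<in> B" "y 0 \<in> B" using PiE_mem[OF p(2)] PiE_mem[OF p(3)] by simp_all
    have "x 0 = y 0" using assms(2) p(4) mem by (rule inj_onD)
    then have "x = ?g (x 0)" "y = ?g (x 0)"
      using p(2,3) by (auto simp: fun_eq_iff PiE_def extensional_def)
    then show "p \<in> (\<lambda>b. (?g b, ?g b)) ` B"
      unfolding p(1) using mem(1) by (intro image_eqI[of _ _ "x 0"]) auto
  qed
  then show ?thesis
    unfolding energy_def by (rule surj_card_le[OF assms(1)])
qed

lemma strictly_monotone_imp_inj: "strictly_monotone f \<Longrightarrow> inj f"
  unfolding strictly_monotone_def inj_def by (metis less_irrefl linorder_neqE_linordered_idom)

text \<open>The new constant \<open>8 ^ k * (1 + C)\<close>, with \<open>k = 2 ^ Suc s\<close>,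
  involves neither \<open>B\<close> nor \<open>f\<close>, so the induction yields a constant
  depending on \<open>s\<close> alone.\<close>

lemma energy_step:
  assumes fin: "finite B" and ne: "B \<noteq> {}" and f: "s_convex (Suc s) f" and C: "C > 0"
    and IH: "\<And>B g. finite B \<Longrightarrow> s_convex s g \<Longrightarrow> real (energy (2 ^ s) (\<lambda>_. B) (\<lambda>_. g)) \<le>
      C * (real (card (sumdiff B)) powr (2 * (2 ^ s - saving s)) * real (card B) powr saving s)"
  shows "real (energy (2 ^ Suc s) (\<lambda>_. B) (\<lambda>_. f)) \<le> 8 ^ 2 ^ Suc s * (1 + C) *
    (real (card (sumdiff B)) powr (2 * (2 ^ Suc s - saving (Suc s))) * real (card B) powr saving (Suc s))"
proof -
  define k :: nat where "k = 2 ^ Suc s"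
  define n where "n = real (card B)"
  define L where "L = real (card (sumdiff B))"
  \<comment> \<open>This is the increment \<open>saving (Suc s) - saving s\<close>. Since
    \<open>u powr \<theta> \<ge> 1\<close>, rounding up to the integer \<open>t\<close> at most
    doubles it.\<close>
  define \<theta> where "\<theta> = 1 - real (Suc s) / 2 ^ Suc s"
  define u where "u = L\<^sup>2 / n"
  define t where "t = nat \<lceil>u powr \<theta>\<rceil>"
  have k: "k > 0" "even k" "k = 2 * 2 ^ s" "real k = 2 * 2 ^ s" unfolding k_def by auto
  have n1: "1 \<le> n" unfolding n_def using fin ne by (simp add: Suc_leI card_gt_0_iff)
  have nL: "n \<le> L" unfolding n_def L_def
    using fin by (intro of_nat_mono card_mono finite_sumdiff subset_sumdiff)
  have \<theta>: "\<theta> \<ge> 0"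
    using Suc_le_two_power[of "Suc s"] unfolding \<theta>_def by simp
  have "n * 1 \<le> L * L" using n1 nL by (intro mult_mono) auto
  then have u: "u \<ge> 1" using n1 unfolding u_def by (simp add: power2_eq_square)
  then have u\<theta>: "u powr \<theta> \<ge> 1" using \<theta> by (rule ge_one_powr_ge_zero)
  have t: "u powr \<theta> \<le> real t" "real t \<le> 2 * u powr \<theta>"
    using u\<theta> unfolding t_def by linarith+
  then have t0: "t > 0" using u\<theta> by linarith
  obtain c :: "real \<Rightarrow> nat" where c: "\<And>x y. x \<le> y \<Longrightarrow> c x \<le> c y" "\<And>b. b \<in> B \<Longrightarrow> c b < t"
    "card {y - x | x y. x \<in> B \<and> y \<in> B \<and> x \<noteq> y \<and> c x = c y} * t \<le> 2 * card (sumdiff B)"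
    using exists_cells[OF fin t0] by blast
  define H where "H = {y - x | x y. x \<in> B \<and> y \<in> B \<and> x \<noteq> y \<and> c x = c y}"
  have "H \<subseteq> (\<lambda>p. snd p - fst p) ` (B \<times> B)" unfolding H_def by force
  then have finH: "finite H" using fin by (meson finite_SigmaI finite_imageI finite_subset)
  define M where "M = real (card H)"
  have "real (card H * t) \<le> real (2 * card (sumdiff B))"
    using c(3) unfolding H_def by (rule of_nat_mono)
  then have M: "0 \<le> M" "M * real t \<le> 2 * L" unfolding M_def L_def by simp_all
  let ?B = "\<lambda>h. {b\<in>B. b + h \<in> B \<and> c b = c (b + h)}"
  let ?f = "\<lambda>h x. f (x + h) - f x"
  let ?e = "\<lambda>h. real (energy (2 ^ s) (\<lambda>_. ?B h) (\<lambda>_. ?f h))"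
  let ?S = "\<Sum>w\<in>PiE {..<k} (\<lambda>_. {..<t}). energy k (\<lambda>i. {b\<in>B. c b = w i}) (\<lambda>_. f)"
  define V where "V = C * L powr (real k - 2 * saving s) * n powr saving s"
  have e_le: "?e h \<le> V" if "h \<in> H" for h
  proof -
    have "h \<noteq> 0" using that unfolding H_def by auto
    then have "s_convex s (?f h)" by (rule s_convex_difference[OF f])
    then have "?e h \<le> C * (real (card (sumdiff (?B h))) powr (2 * (2 ^ s - saving s)) *
        real (card (?B h)) powr saving s)"
      using fin by (intro IH) auto
    also have "\<dots> \<le> C * (L powr (2 * (2 ^ s - saving s)) * n powr saving s)"
    proof -
      have "card (sumdiff (?B h)) \<le> card (sumdiff B)"
        using fin by (intro card_mono finite_sumdiff sumdiff_mono) auto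
      moreover have "card (?B h) \<le> card B"
        using fin by (intro card_mono) auto
      ultimately show ?thesis
        using saving_ge_1[of s] saving_le[of s] C unfolding L_def n_def
        by (intro mult_left_mono mult_mono powr_mono2) auto
    qed
    finally show ?thesis unfolding V_def k(4) by (simp add: right_diff_distrib)
  qed
  have mean1: "has_mean (\<lambda>\<xi>. (\<Sum>j<t. (cmod (expsum {b\<in>B. c b = j} f \<xi>))\<^sup>2) ^ k) (real ?S)"
    by (rule has_mean_cells[OF fin])
  have mean2: "has_mean (\<lambda>\<xi>. 2 ^ k * (n ^ k + M ^ (k - 1) *
      (\<Sum>h\<in>H. \<Prod>i<(2 ^ s :: nat). (cmod (expsum (?B h) (?f h) \<xi>))\<^sup>2)))
      (2 ^ k * (n ^ k + M ^ (k - 1) * (\<Sum>h\<in>H. ?e h)))"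
    by (intro has_mean_cmult has_mean_add has_mean_const has_mean_sum has_mean_energy finH)
      (use fin in auto)
  \<comment> \<open>The shifts are separated pointwise in the frequency and only then averaged, so
    no energy mixing several shifts has to be estimated.\<close>
  have "real ?S \<le> 2 ^ k * (n ^ k + M ^ (k - 1) * (\<Sum>h\<in>H. ?e h))"
  proof (rule has_mean_mono[OF mean1 mean2])
    fix \<xi>
    let ?F = "\<lambda>h. cmod (expsum (?B h) (?f h) \<xi>)"
    \<comment> \<open>As \<open>k = 2 * 2 ^ s\<close>, a \<open>k\<close>-th power is a product of
      \<open>2 ^ s\<close> squared moduli: exactly an energy at level \<open>s\<close>.\<close>
    have pow: "(\<Prod>i<(2 ^ s :: nat). (?F h)\<^sup>2) = ?F h ^ k" for h
      unfolding k(3) by (simp add: power_mult)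
    have "(\<Sum>j<t. (cmod (expsum {b\<in>B. c b = j} f \<xi>))\<^sup>2) \<le> n + (\<Sum>h\<in>H. ?F h)"
      unfolding n_def by (rule sum_cells_le_differences[OF fin c(2) H_def])
    then have "(\<Sum>j<t. (cmod (expsum {b\<in>B. c b = j} f \<xi>))\<^sup>2) ^ k \<le> (n + (\<Sum>h\<in>H. ?F h)) ^ k"
      by (intro power_mono sum_nonneg) auto
    also have "\<dots> \<le> 2 ^ k * (n ^ k + (\<Sum>h\<in>H. ?F h) ^ k)"
      using n1 by (intro power_add_le sum_nonneg) auto
    also have "\<dots> \<le> 2 ^ k * (n ^ k + M ^ (k - 1) * (\<Sum>h\<in>H. ?F h ^ k))"
      unfolding M_def using k by (intro mult_left_mono add_left_mono power_sum_le_even) auto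
    finally show "(\<Sum>j<t. (cmod (expsum {b\<in>B. c b = j} f \<xi>))\<^sup>2) ^ k \<le>
       2 ^ k * (n ^ k + M ^ (k - 1) * (\<Sum>h\<in>H. \<Prod>i<(2 ^ s :: nat). (?F h)\<^sup>2))"
      unfolding pow .
  qed
  also have "\<dots> \<le> 2 ^ k * (n ^ k + M ^ (k - 1) * (M * V))"
    using M(1) sum_bounded_above[of H ?e V, OF e_le] unfolding M_def
    by (intro mult_left_mono add_left_mono) auto
  also have "M ^ (k - 1) * (M * V) = M ^ k * V"
    using k(1) by (cases k) simp_all
  finally have S: "real ?S \<le> 2 ^ k * (n ^ k + M ^ k * V)" .
  have f_mono: "strictly_monotone f"
  proof -
    have "strictly_monotone ((deriv ^^ 0) f)" using f unfolding s_convex_def by blast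
    then show ?thesis by simp
  qed
  have "real (energy k (\<lambda>_. B) (\<lambda>_. f)) \<le> real ((2 * t) ^ (k - 1) * ?S)"
    by (intro of_nat_mono energy_le_sum_cells fin f_mono c k)
  also have "\<dots> = (2 * real t) ^ (k - 1) * real ?S"
    by simp
  also have "\<dots> \<le> (2 * real t) ^ (k - 1) * (2 ^ k * (n ^ k + M ^ k * V))"
    using S by (intro mult_left_mono) auto
  also have "\<dots> \<le> 8 ^ k * (1 + C) *
      (L powr (2 * (real k - saving (Suc s))) * n powr saving (Suc s))"
    unfolding V_def
  proof (rule balance_terms[OF n1 nL k(1)])
    show "\<theta> * (real k - 1) \<le> real k - saving (Suc s)"
      using saving_step_le[of "Suc s"] unfolding \<theta>_def k_def by simp
    show "saving (Suc s) = saving s + \<theta>"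
      unfolding \<theta>_def by (rule saving_Suc)
  qed (use t M C in \<open>auto simp: u_def\<close>)
  finally show ?thesis
    unfolding k_def L_def n_def by (simp only: of_nat_power of_nat_numeral)
qed

lemma energy_bound:
  "\<exists>C>0. \<forall>B f. finite B \<longrightarrow> s_convex s f \<longrightarrow> real (energy (2 ^ s) (\<lambda>_. B) (\<lambda>_. f)) \<le>
    C * (real (card (sumdiff B)) powr (2 * (2 ^ s - saving s)) * real (card B) powr saving s)"
proof (induction s)
  case 0
  have "real (energy (2 ^ 0) (\<lambda>_. B) (\<lambda>_. f)) \<le>
    1 * (real (card (sumdiff B)) powr (2 * (2 ^ 0 - saving 0)) * real (card B) powr saving 0)"
    if fin: "finite B" and f: "s_convex 0 f" for B f
  proof (cases "B = {}")
    case True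
    then show ?thesis by (simp add: energy_empty)
  next
    case False
    have "strictly_monotone f" using f unfolding s_convex_def by simp
    then have "energy 1 (\<lambda>_. B) (\<lambda>_. f) \<le> card B"
      using fin strictly_monotone_imp_inj inj_on_subset by (intro energy_one) blast+
    \<comment> \<open>The exponent of \<open>card (sumdiff B)\<close> is \<open>0\<close> here, and
      \<open>0 powr 0 = 0\<close>, so the base must be nonzero for the factor to be
      \<open>1\<close>.\<close>
    moreover have "sumdiff B \<noteq> {}" using False subset_sumdiff[of B] by blast
    then have "real (card (sumdiff B)) \<noteq> 0" using fin finite_sumdiff by simp
    ultimately show ?thesis by (simp add: saving_def alpha_def)
  qed
  then show ?case by (intro exI[of _ 1]) auto
next
  case (Suc s)
  then obtain C where C: "C > 0" and IH: "\<And>B g. finite B \<Longrightarrow> s_convex s g \<Longrightarrow>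
      real (energy (2 ^ s) (\<lambda>_. B) (\<lambda>_. g)) \<le>
      C * (real (card (sumdiff B)) powr (2 * (2 ^ s - saving s)) * real (card B) powr saving s)"
    by blast
  have "real (energy (2 ^ Suc s) (\<lambda>_. B) (\<lambda>_. f)) \<le> 8 ^ 2 ^ Suc s * (1 + C) *
    (real (card (sumdiff B)) powr (2 * (2 ^ Suc s - saving (Suc s))) * real (card B) powr saving (Suc s))"
    if "finite B" "s_convex (Suc s) f" for B f
  proof (cases "B = {}")
    case True
    then have "energy (2 ^ Suc s) (\<lambda>_. B) (\<lambda>_. f) = 0" by (intro energy_empty) auto
    then show ?thesis using C by simp
  next
    case False
    show ?thesis by (rule energy_step[OF that(1) False that(2) C IH])
  qed
  moreover have "8 ^ 2 ^ Suc s * (1 + C) > 0" using C by simp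
  ultimately show ?case by blast
qed

text \<open>Each factor is divided by \<open>V i powr (1 / k)\<close> before AM-GM. All normalised
  energies are then at most \<open>C\<close>, and the result is the geometric mean of the
  \<open>V i\<close> instead of their arithmetic mean.\<close>

lemma energy_le_prod:
  fixes V :: "nat \<Rightarrow> real"
  assumes k: "k > 0" and fin: "\<And>i. i < k \<Longrightarrow> finite (B i)" and V: "\<And>i. i < k \<Longrightarrow> V i > 0"
    and le: "\<And>i. i < k \<Longrightarrow> real (energy k (\<lambda>_. B i) (\<lambda>_. f i)) \<le> C * V i"
  shows "real (energy k B f) \<le> C * (\<Prod>i<k. V i powr (1 / k))"
proof -
  let ?F = "\<lambda>i \<xi>. (cmod (expsum (B i) (f i) \<xi>))\<^sup>2"
  define P where "P = (\<Prod>i<k. V i powr (1 / k))"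
  have P: "P \<ge> 0" unfolding P_def by (intro prod_nonneg) auto
  have mean1: "has_mean (\<lambda>\<xi>. \<Prod>i<k. ?F i \<xi>) (real (energy k B f))"
    using fin by (rule has_mean_energy)
  have mean2: "has_mean (\<lambda>\<xi>. P / k * (\<Sum>i<k. 1 / V i * (\<Prod>j<k. ?F i \<xi>)))
     (P / k * (\<Sum>i<k. 1 / V i * real (energy k (\<lambda>_. B i) (\<lambda>_. f i))))"
    by (intro has_mean_cmult has_mean_sum has_mean_energy) (use fin in auto)
  have "real (energy k B f) \<le> P / k * (\<Sum>i<k. 1 / V i * real (energy k (\<lambda>_. B i) (\<lambda>_. f i)))"
  proof (rule has_mean_mono[OF mean1 mean2])
    fix \<xi>
    let ?x = "\<lambda>i. ?F i \<xi> / V i powr (1 / k)"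
    have x_pow: "?x i ^ k = 1 / V i * (\<Prod>j<k. ?F i \<xi>)" if "i < k" for i
      using V[OF that] k by (simp add: power_divide powr_powr flip: powr_realpow)
    have "(\<Prod>i<k. ?F i \<xi>) = P * (\<Prod>i<k. ?x i)"
    proof -
      have "(\<Prod>i<k. ?F i \<xi>) = (\<Prod>i<k. V i powr (1 / k) * ?x i)"
        by (rule prod.cong) (use V in \<open>auto simp: less_imp_neq[symmetric]\<close>)
      then show ?thesis unfolding P_def by (simp only: prod.distrib)
    qed
    also have "\<dots> \<le> P * ((\<Sum>i<k. ?x i ^ k) / k)"
      using P k by (intro mult_left_mono prod_le_mean_powers) auto
    also have "\<dots> = P / k * (\<Sum>i<k. 1 / V i * (\<Prod>j<k. ?F i \<xi>))"
      using x_pow by simp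
    finally show "(\<Prod>i<k. ?F i \<xi>) \<le> P / k * (\<Sum>i<k. 1 / V i * (\<Prod>j<k. ?F i \<xi>))" .
  qed
  also have "\<dots> \<le> P / k * (\<Sum>i<k. C)"
  proof (intro mult_left_mono sum_mono)
    fix i assume "i \<in> {..<k}"
    then show "1 / V i * real (energy k (\<lambda>_. B i) (\<lambda>_. f i)) \<le> C"
      using le[of i] V[of i] by (simp add: field_simps)
  qed (use P in simp)
  also have "\<dots> = C * P" using k by simp
  finally show ?thesis unfolding P_def .
qed

theorem theorem1p5:
  fixes s :: nat
  shows "\<exists>C>0. \<forall>(N::nat) (B::nat \<Rightarrow> real set) (f::nat \<Rightarrow> real \<Rightarrow> real).
     (\<forall>i<2^s. finite (B i) \<and> card (B i) = N \<and> s_convex s (f i)) \<longrightarrow>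
     real (T_energy (2^s) (\<lambda>i. f i ` B i))
       \<le> C * (\<Prod>i<2^s. (real (card (sumdiff (B i))) / real N)
                 powr (2 - (2 + 2 * real s - 2 * alpha s) / 2 ^ s))
           * real N powr (2 ^ (s + 1) - 1 - real s + alpha s)"
proof -
  let ?k = "2 ^ s :: nat"
  let ?a = "2 - (2 + 2 * real s - 2 * alpha s) / 2 ^ s"
  let ?b = "2 ^ (s + 1) - 1 - real s + alpha s"
  obtain C where C: "C > 0" and bound: "\<And>B f. finite B \<Longrightarrow> s_convex s f \<Longrightarrow>
      real (energy (2 ^ s) (\<lambda>_. B) (\<lambda>_. f)) \<le>
      C * (real (card (sumdiff B)) powr (2 * (2 ^ s - saving s)) * real (card B) powr saving s)"
    using energy_bound[of s] by blast
  have "real (T_energy ?k (\<lambda>i. f i ` B i)) \<le>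
      C * (\<Prod>i<?k. (real (card (sumdiff (B i))) / real N) powr ?a) * real N powr ?b"
    if hyp: "\<forall>i<?k. finite (B i) \<and> card (B i) = N \<and> s_convex s (f i)"
    for N :: nat and B :: "nat \<Rightarrow> real set" and f :: "nat \<Rightarrow> real \<Rightarrow> real"
  proof -
    have T: "T_energy ?k (\<lambda>i. f i ` B i) \<le> energy ?k B f"
      using hyp by (intro T_energy_image_le) auto
    show ?thesis
    proof (cases "N = 0")
      case True
      have "B 0 = {}" using hyp[rule_format, of 0] True by auto
      then have "energy ?k B f = 0" by (intro energy_empty) auto
      then show ?thesis using T True by simp
    next
      case False
      define V where "V i = real (card (sumdiff (B i))) powr (2 * (2 ^ s - saving s)) *
        real N powr saving s" for i
      have card_pos: "real (card (sumdiff (B i))) > 0" if "i < ?k" for i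
      proof -
        have "B i \<noteq> {}" "finite (B i)" using hyp[rule_format, OF that] False by auto
        then have "sumdiff (B i) \<noteq> {}" "finite (sumdiff (B i))"
          using subset_sumdiff[of "B i"] finite_sumdiff by blast+
        then show ?thesis by (simp add: card_gt_0_iff)
      qed
      have V_pos: "V i > 0" if "i < ?k" for i
        using card_pos[OF that] False unfolding V_def by simp
      \<comment> \<open>The \<open>k\<close>-th root has exponents \<open>?a\<close> on
        \<open>card (sumdiff (B i))\<close> and \<open>saving s / ?k\<close> on \<open>N\<close>.
        Dividing the cardinality by \<open>N\<close> moves \<open>?a\<close> more to
        \<open>N\<close>, and \<open>?a + saving s / ?k = ?b / ?k\<close>.\<close>
      have root: "V i powr (1 / ?k) =
          (real (card (sumdiff (B i))) / real N) powr ?a * real N powr (?b / ?k)" if "i < ?k" for i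
      proof -
        have a: "?a = 2 * (2 ^ s - saving s) / ?k"
          unfolding saving_def by (simp add: field_simps)
        have b: "?b / ?k = ?a + saving s / ?k"
          unfolding saving_def by (simp add: field_simps)
        have "V i powr (1 / ?k) =
            real (card (sumdiff (B i))) powr ?a * real N powr (saving s / ?k)"
          using card_pos[OF that] False unfolding V_def a by (simp add: powr_mult powr_powr)
        then show ?thesis
          unfolding b powr_add using card_pos[OF that] False by (simp add: powr_divide)
      qed
      have "real (energy ?k B f) \<le> C * (\<Prod>i<?k. V i powr (1 / ?k))"
      proof (rule energy_le_prod)
        fix i assume "i < ?k"
        then have "finite (B i)" "card (B i) = N" "s_convex s (f i)" using hyp by auto
        then show "real (energy ?k (\<lambda>_. B i) (\<lambda>_. f i)) \<le> C * V i"
          using bound[of "B i" "f i"] unfolding V_def by simp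
      qed (use hyp V_pos in auto)
      also have "(\<Prod>i<?k. V i powr (1 / ?k)) =
          (\<Prod>i<?k. (real (card (sumdiff (B i))) / real N) powr ?a) * (real N powr (?b / ?k)) ^ ?k"
        using root by (simp add: prod.distrib)
      also have "(real N powr (?b / ?k)) ^ ?k = real N powr ?b"
        using False by (simp add: powr_powr flip: powr_realpow)
      finally show ?thesis using T by (simp add: mult.assoc)
    qed
  qed
  with C show ?thesis by blast
qed

end
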